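(* There exists an infinite family of graphs $G$ (with $|V(G)|$ unbounded) such that the nondeterministic communication complexity of the clique vs. independent set problem on $G$ is at least $(2-o(1))\log_2|V(G)|$; that is, there are graphs $G_1,G_2,\dots$ with $|V(G_t)|\to\infty$ and a function $\varepsilon$ with $\varepsilon(t)\to0$ such that this complexity for $G_t$ is at least $(2-\varepsilon(t))\log_2|V(G_t)|$.
   Context: For a graph $G$, in the clique vs. independent set problem Alice receives a clique $C$ of $G$ and Bob receives an independent set $I$ of $G$ (so $|C\cap I|\le 1$), and they must decide whether $C\cap I=\emptyset$. The nondeterministic communication complexity here refers to certifying the disjoint case: it is (up to rounding) $\log_2$ of the minimum number of combinatorial rectangles $\mathcal{A}\times\mathcal{I}$ ($\mathcal{A}$ a set of cliques, $\mathcal{I}$ a set of independent sets, with $C\cap I=\emptyset$ for all $C\in\mathcal{A}, I\in\mathcal{I}$) needed to cover all pairs $(C,I)$ with $C\cap I=\emptyset$. *)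

theory Defs
  imports Complex_Main "HOL-Library.Ramsey"
begin

definition fin_sgraph :: "'a set \<Rightarrow> 'a set set \<Rightarrow> bool" where
  "fin_sgraph V E \<longleftrightarrow> finite V \<and> E \<subseteq> [V]\<^bsup>2\<^esup>"

definition cliques :: "'a set \<Rightarrow> 'a set set \<Rightarrow> 'a set set" where
  "cliques V E = {C. C \<subseteq> V \<and> clique C E}"

definition indep_sets :: "'a set \<Rightarrow> 'a set set \<Rightarrow> 'a set set" where
  "indep_sets V E = {I. I \<subseteq> V \<and> indep I E}"

text \<open>A pair \<open>(A, B)\<close> stands for the combinatorial rectangle \<open>A \<times> B\<close>.\<close>

definition disjointness_cover ::
    "'a set \<Rightarrow> 'a set set \<Rightarrow> ('a set set \<times> 'a set set) set \<Rightarrow> bool" where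
  "disjointness_cover V E R \<longleftrightarrow>
     finite R \<and>
     (\<forall>(A, B) \<in> R. A \<subseteq> cliques V E \<and> B \<subseteq> indep_sets V E \<and> (\<forall>C\<in>A. \<forall>I\<in>B. C \<inter> I = {})) \<and>
     (\<forall>C \<in> cliques V E. \<forall>I \<in> indep_sets V E. C \<inter> I = {} \<longrightarrow> (\<exists>(A, B) \<in> R. C \<in> A \<and> I \<in> B))"

definition cis_cover_number :: "'a set \<Rightarrow> 'a set set \<Rightarrow> nat" where
  "cis_cover_number V E = (LEAST k. \<exists>R. disjointness_cover V E R \<and> card R = k)"

text \<open>No rounding to an integer is applied: this is at most the rounded-up cost, so a lower bound
  on it is also a lower bound on the number of certificate bits.\<close>

definition cis_nondet_cc :: "'a set \<Rightarrow> 'a set set \<Rightarrow> real" where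
  "cis_nondet_cc V E = log 2 (real (cis_cover_number V E))"

text \<open>The minimum is taken over a nonempty set.\<close>

lemma disjointness_cover_exists:
  assumes "fin_sgraph V E"
  shows "\<exists>R. disjointness_cover V E R"
proof -
  have "finite V" using assms by (simp add: fin_sgraph_def)
  then have fin: "finite (cliques V E)" "finite (indep_sets V E)"
    by (auto simp: cliques_def indep_sets_def)
  define P where "P = {(C, I) \<in> cliques V E \<times> indep_sets V E. C \<inter> I = {}}"
  have "finite P"
    by (rule finite_subset[of _ "cliques V E \<times> indep_sets V E"]) (use fin in \<open>auto simp: P_def\<close>)
  then have "disjointness_cover V E ((\<lambda>(C, I). ({C}, {I})) ` P)"
    unfolding disjointness_cover_def by (fastforce simp: P_def)
  then show ?thesis ..
qed

lemma cis_cover_number_attained: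
  assumes "fin_sgraph V E"
  shows "\<exists>R. disjointness_cover V E R \<and> card R = cis_cover_number V E"
  unfolding cis_cover_number_def
  by (rule LeastI_ex) (use disjointness_cover_exists[OF assms] in blast)

end

theory Submission
  imports Defs "HOL-Library.Disjoint_Sets" "HOL-Real_Asymp.Real_Asymp"
begin

text \<open>
  Cover the complete graph on \<open>W\<close> by directed bicliques \<open>A x \<times> B x\<close> so that every edge gets at least
  one direction and no direction twice (an ordered biclique partition, after Shigeta and Amano).
  Make \<open>x\<close> and \<open>y\<close> adjacent whenever some \<open>v\<close> lies in \<open>A x \<inter> A y\<close>. Then every \<open>{x. v \<in> A x}\<close> is a
  clique, every \<open>{x. v \<in> B x}\<close> is independent, and these pairs form a fooling set, so that \<open>card W\<close>
  rectangles are needed.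

  Let \<open>W\<close> consist of the words of length \<open>2h + 1\<close> over \<open>k\<close> letters, and compare two words through
  the set \<open>D\<close> of positions where they differ. Suppose that the nonempty sets \<open>D\<close> are covered by
  subcubes which prescribe at most \<open>h + 1\<close> positions each and carry a sign and a label, such that two
  subcubes that meet have the same label and opposite signs. A subcube together with the letters of
  \<open>u\<close> on its prescribed positions gives a biclique, joining \<open>u\<close> to \<open>v\<close> when \<open>D\<close> lies in the subcube
  and the letters of \<open>u\<close> and \<open>v\<close> at the label are ordered as the sign says. These are only
  \<open>O(h\<^sup>2 k\<^bsup>h+1\<^esup>)\<close> bicliques for \<open>k\<^bsup>2h+1\<^esup>\<close> words.

  The positive subcubes, the arcs, say that \<open>p \<in> D\<close> and that none of the \<open>h\<close> positions cyclically
  following \<open>p\<close> is in \<open>D\<close>. The negative ones are the leaves of a decision tree: query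
  \<open>h, h - 1, \<dots>, 1\<close> until some \<open>t \<in> D\<close> is found, then query \<open>t + h, \<dots>, h + 1\<close> until some \<open>p \<in> D\<close>
  is found. If one of the searches fails, \<open>D\<close> is empty or in an arc. Both kinds are labelled by \<open>p\<close>.
\<close>

section \<open>Ordered biclique partitions\<close>

lemma cis_cover_number_ge_fooling_set:
  assumes "fin_sgraph V E"
    and clique: "\<And>v. v \<in> W \<Longrightarrow> C v \<in> cliques V E"
    and indep: "\<And>v. v \<in> W \<Longrightarrow> I v \<in> indep_sets V E"
    and disjoint: "\<And>v. v \<in> W \<Longrightarrow> C v \<inter> I v = {}"
    and meet: "\<And>u v. u \<in> W \<Longrightarrow> v \<in> W \<Longrightarrow> u \<noteq> v \<Longrightarrow> C u \<inter> I v \<noteq> {} \<or> C v \<inter> I u \<noteq> {}"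
  shows "card W \<le> cis_cover_number V E"
proof -
  obtain R where cover_R: "disjointness_cover V E R" and card_R: "card R = cis_cover_number V E"
    using cis_cover_number_attained[OF assms(1)] by blast
  have "\<forall>v\<in>W. \<exists>r\<in>R. C v \<in> fst r \<and> I v \<in> snd r"
    using cover_R clique indep disjoint unfolding disjointness_cover_def by fastforce
  then obtain \<rho> where \<rho>_covers: "\<And>v. v \<in> W \<Longrightarrow> \<rho> v \<in> R \<and> C v \<in> fst (\<rho> v) \<and> I v \<in> snd (\<rho> v)"
    by metis
  have rectangle: "A \<inter> B = {}" if "r \<in> R" "A \<in> fst r" "B \<in> snd r" for r A B
    using cover_R that unfolding disjointness_cover_def by fastforce
  have "inj_on \<rho> W"
  proof (rule inj_onI, rule ccontr)
    fix u v assume "u \<in> W" "v \<in> W" "\<rho> u = \<rho> v" "u \<noteq> v"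
    then have "C u \<inter> I v = {}" "C v \<inter> I u = {}"
      using \<rho>_covers[of u] \<rho>_covers[of v] rectangle by metis+
    then show False
      using meet \<open>u \<in> W\<close> \<open>v \<in> W\<close> \<open>u \<noteq> v\<close> by blast
  qed
  moreover have "\<rho> ` W \<subseteq> R" using \<rho>_covers by blast
  moreover have "finite R" using cover_R by (simp add: disjointness_cover_def)
  ultimately show ?thesis
    unfolding card_R[symmetric] by (rule card_inj_on_le)
qed

definition ordered_biclique_partition ::
    "'w set \<Rightarrow> 'x set \<Rightarrow> ('x \<Rightarrow> 'w set) \<Rightarrow> ('x \<Rightarrow> 'w set) \<Rightarrow> bool" where
  "ordered_biclique_partition W X A B \<longleftrightarrow>
     (\<forall>x\<in>X. A x \<subseteq> W \<and> B x \<subseteq> W \<and> A x \<inter> B x = {}) \<and>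
     disjoint_family_on (\<lambda>x. A x \<times> B x) X \<and>
     total_on W (\<Union>x\<in>X. A x \<times> B x)"

lemma ordered_biclique_partition_reindex:
  assumes "ordered_biclique_partition W X A B" and bij_f: "bij_betw f Y X"
  shows "ordered_biclique_partition W Y (A \<circ> f) (B \<circ> f)"
proof -
  have "disjoint_family_on (\<lambda>y. (A \<circ> f) y \<times> (B \<circ> f) y) Y"
    using assms unfolding ordered_biclique_partition_def disjoint_family_on_def
    by (metis bij_betwE bij_betw_imp_inj_on comp_apply inj_onD)
  moreover have "f ` Y = X" using bij_f by (rule bij_betw_imp_surj_on)
  ultimately show ?thesis
    using assms(1) unfolding ordered_biclique_partition_def by auto
qed

definition biclique_graph :: "'w set \<Rightarrow> 'x set \<Rightarrow> ('x \<Rightarrow> 'w set) \<Rightarrow> 'x set set" where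
  "biclique_graph W X A = (\<Union>v\<in>W. [{x \<in> X. v \<in> A x}]\<^bsup>2\<^esup>)"

lemma doubleton_mem_biclique_graph_iff:
  assumes "x \<noteq> y"
  shows "{x, y} \<in> biclique_graph W X A \<longleftrightarrow> x \<in> X \<and> y \<in> X \<and> (\<exists>v\<in>W. v \<in> A x \<and> v \<in> A y)"
  using assms by (auto simp: biclique_graph_def nsets_def)

lemma cis_cover_number_biclique_graph_ge:
  assumes "finite V" and "X \<subseteq> V" and partition: "ordered_biclique_partition W X A B"
  shows "fin_sgraph V (biclique_graph W X A)"
    and "card W \<le> cis_cover_number V (biclique_graph W X A)"
proof -
  show graph: "fin_sgraph V (biclique_graph W X A)"
    using \<open>finite V\<close> \<open>X \<subseteq> V\<close> by (fastforce simp: fin_sgraph_def biclique_graph_def nsets_def)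
  show "card W \<le> cis_cover_number V (biclique_graph W X A)"
  proof (rule cis_cover_number_ge_fooling_set[OF graph])
    fix v assume "v \<in> W"
    show "{x \<in> X. v \<in> A x} \<in> cliques V (biclique_graph W X A)"
      using \<open>v \<in> W\<close> \<open>X \<subseteq> V\<close>
      by (auto simp: cliques_def clique_def doubleton_mem_biclique_graph_iff)
    have "{x, y} \<notin> biclique_graph W X A"
      if "x \<in> X" "y \<in> X" "v \<in> B x" "v \<in> B y" "x \<noteq> y" for x y
    proof -
      have "(A x \<times> B x) \<inter> (A y \<times> B y) = {}"
        using partition that by (simp add: ordered_biclique_partition_def disjoint_family_on_def)
      then show ?thesis
        using that by (auto simp: doubleton_mem_biclique_graph_iff)
    qed
    then show "{x \<in> X. v \<in> B x} \<in> indep_sets V (biclique_graph W X A)"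
      using \<open>X \<subseteq> V\<close> by (auto simp: indep_sets_def indep_def)
    show "{x \<in> X. v \<in> A x} \<inter> {x \<in> X. v \<in> B x} = {}"
      using partition by (auto simp: ordered_biclique_partition_def)
  next
    fix u v assume "u \<in> W" "v \<in> W" "u \<noteq> v"
    moreover have "total_on W (\<Union>x\<in>X. A x \<times> B x)"
      using partition by (simp add: ordered_biclique_partition_def)
    ultimately have "(u, v) \<in> (\<Union>x\<in>X. A x \<times> B x) \<or> (v, u) \<in> (\<Union>x\<in>X. A x \<times> B x)"
      unfolding total_on_def by blast
    then show "{x \<in> X. u \<in> A x} \<inter> {x \<in> X. v \<in> B x} \<noteq> {} \<or>
        {x \<in> X. v \<in> A x} \<inter> {x \<in> X. u \<in> B x} \<noteq> {}"
      by blast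
  qed
qed

lemma ordered_biclique_partition_imp_graph:
  assumes partition: "ordered_biclique_partition W X A B" and "finite X" and "card X \<le> n"
  shows "\<exists>E. fin_sgraph {..<n} E \<and> card W \<le> cis_cover_number {..<n} E"
proof -
  obtain f where bij_f: "bij_betw f {..<card X} X"
    using ex_bij_betw_nat_finite[OF \<open>finite X\<close>] by (auto simp: atLeast0LessThan)
  have "{..<card X} \<subseteq> {..<n}" using \<open>card X \<le> n\<close> by simp
  note cis_cover_number_biclique_graph_ge[OF finite_lessThan this
      ordered_biclique_partition_reindex[OF partition bij_f]]
  then show ?thesis by (intro exI conjI)
qed

section \<open>Signed subcubes\<close>

text \<open>The subcube of index \<open>c\<close> consists of the sets that contain \<open>ones c\<close> and avoid \<open>zeros c\<close>.\<close>

definition compatible :: "('c \<Rightarrow> 'i set) \<Rightarrow> ('c \<Rightarrow> 'i set) \<Rightarrow> 'c \<Rightarrow> 'c \<Rightarrow> bool" where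
  "compatible zeros ones c c' \<longleftrightarrow> ones c \<inter> zeros c' = {} \<and> ones c' \<inter> zeros c = {}"

locale signed_cube_cover =
  fixes S :: "'i set" and F :: "'c set" and zeros ones :: "'c \<Rightarrow> 'i set"
    and label :: "'c \<Rightarrow> 'i" and positive :: "'c \<Rightarrow> bool"
  assumes finite_positions: "finite S" and finite_indices: "finite F"
    and zeros_subset: "c \<in> F \<Longrightarrow> zeros c \<subseteq> S" and ones_subset: "c \<in> F \<Longrightarrow> ones c \<subseteq> S"
    and label_mem_ones: "c \<in> F \<Longrightarrow> label c \<in> ones c"
    and cover: "\<lbrakk>D \<subseteq> S; D \<noteq> {}\<rbrakk> \<Longrightarrow> \<exists>c\<in>F. ones c \<subseteq> D \<and> zeros c \<inter> D = {}"
    and same_label_opposite_sign: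
      "\<lbrakk>c \<in> F; c' \<in> F; c \<noteq> c'; compatible zeros ones c c'\<rbrakk>
        \<Longrightarrow> label c = label c' \<and> positive c \<noteq> positive c'"
begin

definition separates :: "'c \<Rightarrow> ('i \<Rightarrow> 'l::linorder) \<Rightarrow> ('i \<Rightarrow> 'l) \<Rightarrow> bool" where
  "separates c u v \<longleftrightarrow>
     (\<forall>i\<in>zeros c. u i = v i) \<and> (\<forall>i\<in>ones c. u i \<noteq> v i) \<and> (positive c \<longleftrightarrow> u (label c) < v (label c))"

lemma separates_irrefl:
  assumes "c \<in> F"
  shows "\<not> separates c u u"
  using label_mem_ones[OF assms] by (auto simp: separates_def)

lemma separates_unique:
  assumes "c \<in> F" "c' \<in> F" "separates c u v" "separates c' u v"
  shows "c = c'"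
proof (rule ccontr)
  assume "c \<noteq> c'"
  moreover have "compatible zeros ones c c'"
    using assms(3,4) by (auto simp: compatible_def separates_def)
  ultimately have "label c = label c'" "positive c \<noteq> positive c'"
    using same_label_opposite_sign assms(1,2) by blast+
  then show False using assms by (simp add: separates_def)
qed

lemma separates_total:
  assumes "u \<in> S \<rightarrow>\<^sub>E K" "v \<in> S \<rightarrow>\<^sub>E K" "u \<noteq> v"
  shows "\<exists>c\<in>F. separates c u v \<or> separates c v u"
proof -
  define D where "D = {i \<in> S. u i \<noteq> v i}"
  have "D \<noteq> {}" using assms by (auto simp: D_def intro: PiE_ext)
  then obtain c where c_contains_D: "c \<in> F" "ones c \<subseteq> D" "zeros c \<inter> D = {}"
    using cover[of D] by (auto simp: D_def)
  have "\<forall>i\<in>zeros c. u i = v i" "\<forall>i\<in>ones c. u i \<noteq> v i"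
    using c_contains_D zeros_subset[OF \<open>c \<in> F\<close>] by (auto simp: D_def)
  moreover from this have "u (label c) < v (label c) \<longleftrightarrow> \<not> v (label c) < u (label c)"
    using label_mem_ones[OF \<open>c \<in> F\<close>] by (metis linorder_less_linear order_less_asym)
  ultimately show ?thesis
    using \<open>c \<in> F\<close> unfolding separates_def by metis
qed

definition support :: "'c \<Rightarrow> 'i set" where
  "support c = zeros c \<union> ones c"

definition patterns :: "'l set \<Rightarrow> ('c \<times> ('i \<Rightarrow> 'l)) set" where
  "patterns K = (SIGMA c:F. support c \<rightarrow>\<^sub>E K)"

definition tails :: "'l set \<Rightarrow> 'c \<times> ('i \<Rightarrow> 'l) \<Rightarrow> ('i \<Rightarrow> 'l) set" where
  "tails K x = {u \<in> S \<rightarrow>\<^sub>E K. restrict u (support (fst x)) = snd x}"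

definition heads :: "'l::linorder set \<Rightarrow> 'c \<times> ('i \<Rightarrow> 'l) \<Rightarrow> ('i \<Rightarrow> 'l) set" where
  "heads K x = {v \<in> S \<rightarrow>\<^sub>E K. separates (fst x) (snd x) v}"

lemma support_subset:
  assumes "c \<in> F"
  shows "support c \<subseteq> S"
  using zeros_subset[OF assms] ones_subset[OF assms] by (simp add: support_def)

lemma separates_restrict_support:
  assumes "c \<in> F"
  shows "separates c (restrict u (support c)) v \<longleftrightarrow> separates c u v"
  using label_mem_ones[OF assms] by (auto simp: separates_def support_def)

lemma mem_biclique_iff:
  assumes "x \<in> patterns K"
  shows "(u, v) \<in> tails K x \<times> heads K x \<longleftrightarrow>
    u \<in> S \<rightarrow>\<^sub>E K \<and> v \<in> S \<rightarrow>\<^sub>E K \<and> snd x = restrict u (support (fst x)) \<and> separates (fst x) u v"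
  using assms separates_restrict_support[of "fst x" u v]
  by (auto simp: tails_def heads_def patterns_def)

lemma disjoint_family_on_bicliques:
  "disjoint_family_on (\<lambda>x. tails K x \<times> heads K x) (patterns K)"
proof -
  have "x = y"
    if patterns: "x \<in> patterns K" "y \<in> patterns K"
      and edges: "(u, v) \<in> tails K x \<times> heads K x" "(u, v) \<in> tails K y \<times> heads K y" for x y u v
  proof -
    have "fst x \<in> F" "fst y \<in> F" using patterns by (auto simp: patterns_def)
    moreover have "separates (fst x) u v" "separates (fst y) u v"
      and restrictions: "snd x = restrict u (support (fst x))" "snd y = restrict u (support (fst y))"
      using edges
      by (simp_all only: mem_biclique_iff[OF patterns(1)] mem_biclique_iff[OF patterns(2)])
    ultimately have "fst x = fst y" using separates_unique by blast
    with restrictions show ?thesis by (simp add: prod_eq_iff)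
  qed
  then show ?thesis unfolding disjoint_family_on_def by blast
qed

lemma separates_imp_mem_biclique:
  assumes "c \<in> F" "u \<in> S \<rightarrow>\<^sub>E K" "v \<in> S \<rightarrow>\<^sub>E K" "separates c u v"
  shows "(u, v) \<in> (\<Union>x\<in>patterns K. tails K x \<times> heads K x)"
proof -
  define x where "x = (c, restrict u (support c))"
  have x_pattern: "x \<in> patterns K"
    using assms(1,2) support_subset[OF \<open>c \<in> F\<close>] by (fastforce simp: x_def patterns_def PiE_iff)
  then have "(u, v) \<in> tails K x \<times> heads K x"
    using assms unfolding mem_biclique_iff[OF x_pattern] by (simp add: x_def)
  with x_pattern show ?thesis by blast
qed

lemma ordered_biclique_partition_words:
  "ordered_biclique_partition (S \<rightarrow>\<^sub>E K) (patterns K) (tails K) (heads K)"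
  unfolding ordered_biclique_partition_def
proof (intro conjI ballI)
  fix x assume x_pattern: "x \<in> patterns K"
  show "tails K x \<subseteq> S \<rightarrow>\<^sub>E K" "heads K x \<subseteq> S \<rightarrow>\<^sub>E K" by (auto simp: tails_def heads_def)
  have "(u, u) \<notin> tails K x \<times> heads K x" for u
    using x_pattern separates_irrefl[of "fst x" u] unfolding mem_biclique_iff[OF x_pattern]
    by (auto simp: patterns_def)
  then show "tails K x \<inter> heads K x = {}" by blast
next
  show "disjoint_family_on (\<lambda>x. tails K x \<times> heads K x) (patterns K)"
    by (rule disjoint_family_on_bicliques)
next
  show "total_on (S \<rightarrow>\<^sub>E K) (\<Union>x\<in>patterns K. tails K x \<times> heads K x)"
  proof (rule total_onI)
    fix u v assume words: "u \<in> S \<rightarrow>\<^sub>E K" "v \<in> S \<rightarrow>\<^sub>E K" "u \<noteq> v"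
    then obtain c where separating: "c \<in> F" "separates c u v \<or> separates c v u"
      using separates_total by blast
    then show "(u, v) \<in> (\<Union>x\<in>patterns K. tails K x \<times> heads K x) \<or>
        (v, u) \<in> (\<Union>x\<in>patterns K. tails K x \<times> heads K x)"
      using separates_imp_mem_biclique[OF separating(1) words(1,2)]
        separates_imp_mem_biclique[OF separating(1) words(2,1)]
      by argo
  qed
qed

lemma finite_patterns:
  assumes "finite K"
  shows "finite (patterns K)"
  unfolding patterns_def
  using assms finite_indices finite_subset[OF support_subset finite_positions]
  by (auto intro!: finite_PiE)

lemma card_patterns_le:
  assumes "finite K" "K \<noteq> {}" and codim: "\<And>c. c \<in> F \<Longrightarrow> card (support c) \<le> r"
  shows "card (patterns K) \<le> card F * card K ^ r"
proof -
  have finite_support: "finite (support c)" if "c \<in> F" for c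
    using support_subset[OF that] finite_positions by (rule finite_subset)
  then have "card (patterns K) = (\<Sum>c\<in>F. card K ^ card (support c))"
    unfolding patterns_def using finite_indices \<open>finite K\<close>
    by (subst card_SigmaI) (auto intro!: finite_PiE simp: card_PiE)
  also have "\<dots> \<le> (\<Sum>c\<in>F. card K ^ r)"
    using codim assms by (intro sum_mono power_increasing) (auto simp: Suc_le_eq card_gt_0_iff)
  finally show ?thesis by simp
qed

lemma graph_with_cover_number_ge_card_words:
  fixes K :: "'l::linorder set"
  assumes "finite K" "K \<noteq> {}" and "\<And>c. c \<in> F \<Longrightarrow> card (support c) \<le> r"
    and "card F * card K ^ r \<le> n"
  shows "\<exists>E. fin_sgraph {..<n} E \<and> card K ^ card S \<le> cis_cover_number {..<n} E"
proof -
  have "card (patterns K) \<le> n"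
    using card_patterns_le[OF assms(1-3)] assms(4) by (rule order_trans)
  from ordered_biclique_partition_imp_graph[OF ordered_biclique_partition_words
      finite_patterns[OF \<open>finite K\<close>] this]
  show ?thesis using finite_positions by (simp add: card_PiE)
qed

end

section \<open>Cyclic arcs and a decision tree\<close>

definition cyclic_successors :: "nat \<Rightarrow> nat \<Rightarrow> nat set" where
  "cyclic_successors h p = (\<lambda>s. (p + s) mod (2 * h + 1)) ` {1..h}"

lemma mem_cyclic_successors_iff:
  assumes "p \<le> 2 * h"
  shows "j \<in> cyclic_successors h p \<longleftrightarrow> p < j \<and> j \<le> p + h \<and> j \<le> 2 * h \<or> j + h < p"
proof
  assume "j \<in> cyclic_successors h p"
  then obtain s where "1 \<le> s" "s \<le> h" "j = (p + s) mod (2 * h + 1)"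
    by (auto simp: cyclic_successors_def)
  then show "p < j \<and> j \<le> p + h \<and> j \<le> 2 * h \<or> j + h < p"
    using assms by (cases "p + s < 2 * h + 1") (auto simp: le_mod_geq)
next
  assume "p < j \<and> j \<le> p + h \<and> j \<le> 2 * h \<or> j + h < p"
  then consider (forward) "p < j" "j \<le> p + h" "j \<le> 2 * h" | (wrapping) "j + h < p" by blast
  then show "j \<in> cyclic_successors h p"
  proof cases
    case forward
    then show ?thesis unfolding cyclic_successors_def by (intro image_eqI[of _ _ "j - p"]) auto
  next
    case wrapping
    then have "p + (j + (2 * h + 1) - p) = j + (2 * h + 1)" using assms by simp
    then show ?thesis
      unfolding cyclic_successors_def using wrapping assms
      by (intro image_eqI[of _ _ "j + (2 * h + 1) - p"]) (auto simp del: add_Suc_right)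
  qed
qed

datatype cube = is_Arc: Arc (cube_label: nat) | Leaf nat (cube_label: nat)

fun cube_zeros :: "nat \<Rightarrow> cube \<Rightarrow> nat set" where
  "cube_zeros h (Arc p) = cyclic_successors h p"
| "cube_zeros h (Leaf t p) = {t<..h} \<union> {p<..t + h}"

fun cube_ones :: "cube \<Rightarrow> nat set" where
  "cube_ones (Arc p) = {p}"
| "cube_ones (Leaf t p) = {t, p}"

definition cubes :: "nat \<Rightarrow> cube set" where
  "cubes h = Arc ` {..2 * h} \<union> (\<Union>t\<in>{1..h}. Leaf t ` {h<..t + h})"

lemma mem_cubes_iff [simp]:
  "Arc p \<in> cubes h \<longleftrightarrow> p \<le> 2 * h"
  "Leaf t p \<in> cubes h \<longleftrightarrow> 1 \<le> t \<and> t \<le> h \<and> h < p \<and> p \<le> t + h"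
  by (auto simp: cubes_def image_iff)

lemma finite_cubes: "finite (cubes h)"
  by (simp add: cubes_def)

lemma card_cubes_le: "card (cubes h) \<le> (Suc h)\<^sup>2"
proof -
  have "card (\<Union>t\<in>{1..h}. Leaf t ` {h<..t + h}) \<le> (\<Sum>t\<in>{1..h}. card (Leaf t ` {h<..t + h}))"
    by (rule card_UN_le) simp
  also have "\<dots> \<le> (\<Sum>t\<in>{1..h}. h)"
    by (intro sum_mono order_trans[OF card_image_le]) auto
  also have "\<dots> = h * h" by simp
  finally have "card (cubes h) \<le> card (Arc ` {..2 * h}) + h * h"
    unfolding cubes_def using card_Un_le by (meson add_left_mono order_trans)
  also have "card (Arc ` {..2 * h}) = 2 * h + 1" by (simp add: card_image inj_on_def)
  finally show ?thesis by (simp add: power2_eq_square)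
qed

lemma card_cube_zeros_Un_cube_ones_le:
  assumes "c \<in> cubes h"
  shows "card (cube_zeros h c \<union> cube_ones c) \<le> Suc h"
proof (cases c)
  case (Arc p)
  have "card (cyclic_successors h p) \<le> h"
    unfolding cyclic_successors_def using card_image_le[of "{1..h}"] by simp
  then show ?thesis
    using card_Un_le[of "cube_zeros h c" "cube_ones c"] by (simp add: Arc)
next
  case (Leaf t p)
  then have "cube_zeros h c \<union> cube_ones c = {t..h} \<union> {p..t + h}" using assms by auto
  then have "card (cube_zeros h c \<union> cube_ones c) \<le> (Suc h - t) + (Suc (t + h) - p)"
    using card_Un_le[of "{t..h}" "{p..t + h}"] by (simp only: card_atLeastAtMost)
  also have "\<dots> \<le> Suc h" using assms Leaf by auto
  finally show ?thesis .
qed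

lemma greatest_in_intervalE:
  fixes a b :: nat
  assumes "D \<inter> {a..b} \<noteq> {}"
  obtains m where "m \<in> D" "a \<le> m" "m \<le> b" "D \<inter> {m<..b} = {}"
proof -
  let ?m = "Max (D \<inter> {a..b})"
  have Max_mem: "?m \<in> D \<inter> {a..b}" using assms by (intro Max_in) auto
  have "j \<notin> D" if "j \<in> {?m<..b}" for j
    using that Max_mem Max_ge[of "D \<inter> {a..b}" j] by fastforce
  with Max_mem show thesis by (intro that[of ?m]) auto
qed

lemma ex_arc_if_disjoint_from_lower_half:
  assumes "D \<subseteq> {..2 * h}" "D \<noteq> {}" "D \<inter> {1..h} = {}"
  shows "\<exists>p \<le> 2 * h. p \<in> D \<and> cyclic_successors h p \<inter> D = {}"
proof (cases "0 \<in> D")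
  case True
  then show ?thesis
    using assms by (intro exI[of _ 0]) (auto simp: mem_cyclic_successors_iff)
next
  case False
  have above_h: "h < j" if "j \<in> D" for j
    using False assms(3) that by (cases "j = 0") force+
  have "D \<inter> {0..2 * h} \<noteq> {}"
    using assms(1,2) by (simp add: atLeast0AtMost Int_absorb2)
  then obtain p where p_greatest: "p \<in> D" "p \<le> 2 * h" "D \<inter> {p<..2 * h} = {}"
    by (rule greatest_in_intervalE)
  have "j \<notin> D" if "j \<in> cyclic_successors h p" for j
    using that p_greatest above_h[of j] by (auto simp: mem_cyclic_successors_iff)
  with p_greatest show ?thesis by blast
qed

lemma cubes_cover:
  assumes "D \<subseteq> {..2 * h}" "D \<noteq> {}"
  shows "\<exists>c\<in>cubes h. cube_ones c \<subseteq> D \<and> cube_zeros h c \<inter> D = {}"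
proof (cases "D \<inter> {1..h} = {}")
  case True
  then obtain p where "p \<le> 2 * h" "p \<in> D" "cyclic_successors h p \<inter> D = {}"
    using ex_arc_if_disjoint_from_lower_half assms by blast
  then show ?thesis by (intro bexI[of _ "Arc p"]) auto
next
  case False
  then obtain t where t_greatest: "t \<in> D" "1 \<le> t" "t \<le> h" "D \<inter> {t<..h} = {}"
    by (rule greatest_in_intervalE)
  show ?thesis
  proof (cases "D \<inter> {h<..t + h} = {}")
    case True
    have "cyclic_successors h t \<subseteq> {t<..h} \<union> {h<..t + h}"
      using t_greatest by (auto simp: mem_cyclic_successors_iff)
    then show ?thesis using True t_greatest by (intro bexI[of _ "Arc t"]) auto
  next
    case False
    then have "D \<inter> {Suc h..t + h} \<noteq> {}" by (simp add: atLeastSucAtMost_greaterThanAtMost)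
    then obtain p where "p \<in> D" "Suc h \<le> p" "p \<le> t + h" "D \<inter> {p<..t + h} = {}"
      by (rule greatest_in_intervalE)
    then show ?thesis using t_greatest by (intro bexI[of _ "Leaf t p"]) auto
  qed
qed

lemma compatible_arcs_eq:
  assumes "Arc p \<in> cubes h" "Arc q \<in> cubes h"
    and "compatible (cube_zeros h) cube_ones (Arc p) (Arc q)"
  shows "p = q"
  using assms by (auto simp: compatible_def mem_cyclic_successors_iff)

lemma compatible_arc_leaf_label_eq:
  assumes "Arc q \<in> cubes h" "Leaf t p \<in> cubes h"
    and "compatible (cube_zeros h) cube_ones (Arc q) (Leaf t p)"
  shows "q = p"
proof (rule ccontr)
  assume "q \<noteq> p"
  have bounds: "q \<le> 2 * h" "1 \<le> t" "t \<le> h" "h < p" "p \<le> t + h" using assms(1,2) by auto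
  have "q \<notin> {t<..h} \<union> {p<..t + h}"
    and not_successors: "t \<notin> cyclic_successors h q" "p \<notin> cyclic_successors h q"
    using assms(3) by (auto simp: compatible_def)
  then consider "q = t" | "q < t" | "h < q" "q < p" | "t + h < q"
    using \<open>q \<noteq> p\<close> by fastforce
  then have "t \<in> cyclic_successors h q \<or> p \<in> cyclic_successors h q"
    by cases (use bounds in \<open>auto simp: mem_cyclic_successors_iff\<close>)
  with not_successors show False by blast
qed

lemma compatible_leaves_eq:
  assumes "Leaf t p \<in> cubes h" "Leaf t' p' \<in> cubes h"
    and "compatible (cube_zeros h) cube_ones (Leaf t p) (Leaf t' p')"
  shows "t = t'" "p = p'"
proof -
  show "t = t'" using assms by (auto simp: compatible_def)
  then show "p = p'" using assms by (auto simp: compatible_def)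
qed

lemma compatible_cubes_same_label_opposite_sign:
  assumes "c \<in> cubes h" "c' \<in> cubes h" "c \<noteq> c'"
    and "compatible (cube_zeros h) cube_ones c c'"
  shows "cube_label c = cube_label c' \<and> is_Arc c \<noteq> is_Arc c'"
proof (cases c; cases c')
  fix p p' assume "c = Arc p" "c' = Arc p'"
  then show ?thesis using assms compatible_arcs_eq by blast
next
  fix q t p assume "c = Arc q" "c' = Leaf t p"
  then show ?thesis using assms compatible_arc_leaf_label_eq[of q h t p] by simp
next
  fix t p q assume "c = Leaf t p" "c' = Arc q"
  moreover from this have "compatible (cube_zeros h) cube_ones (Arc q) (Leaf t p)"
    using assms(4) by (auto simp: compatible_def)
  ultimately show ?thesis using assms compatible_arc_leaf_label_eq[of q h t p] by simp
next
  fix t p t' p' assume "c = Leaf t p" "c' = Leaf t' p'"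
  then show ?thesis using assms compatible_leaves_eq by blast
qed

lemma signed_cube_cover_cubes:
  "signed_cube_cover {..2 * h} (cubes h) (cube_zeros h) cube_ones cube_label is_Arc"
proof
  fix c assume "c \<in> cubes h"
  then show "cube_zeros h c \<subseteq> {..2 * h}" "cube_ones c \<subseteq> {..2 * h}" "cube_label c \<in> cube_ones c"
    by (cases c; auto simp: mem_cyclic_successors_iff)+
qed (simp, fact finite_cubes, fact cubes_cover, fact compatible_cubes_same_label_opposite_sign)

lemma graph_with_cover_number_ge_power:
  assumes "0 < k"
  shows "\<exists>E. fin_sgraph {..<(Suc h)\<^sup>2 * k ^ Suc h} E \<and>
    k ^ (2 * h + 1) \<le> cis_cover_number {..<(Suc h)\<^sup>2 * k ^ Suc h} E"
proof -
  interpret signed_cube_cover "{..2 * h}" "cubes h" "cube_zeros h" cube_ones cube_label is_Arc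
    by (rule signed_cube_cover_cubes)
  have "card (cubes h) * card {..<k} ^ Suc h \<le> (Suc h)\<^sup>2 * k ^ Suc h"
    using card_cubes_le by simp
  moreover have "card (support c) \<le> Suc h" if "c \<in> cubes h" for c
    using card_cube_zeros_Un_cube_ones_le[OF that] by (simp add: support_def)
  ultimately have "\<exists>E. fin_sgraph {..<(Suc h)\<^sup>2 * k ^ Suc h} E \<and>
      card {..<k} ^ card {..2 * h} \<le> cis_cover_number {..<(Suc h)\<^sup>2 * k ^ Suc h} E"
    using \<open>0 < k\<close> by (intro graph_with_cover_number_ge_card_words) auto
  then show ?thesis by simp
qed

section \<open>Asymptotics\<close>

definition graph_order :: "nat \<Rightarrow> nat" where
  "graph_order t = (Suc t)\<^sup>2 * (2 ^ Suc t) ^ Suc t"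

lemma log_graph_order: "log 2 (graph_order t) = 2 * log 2 (real t + 1) + (real t + 1)\<^sup>2"
proof -
  have "real (graph_order t) = (real t + 1)\<^sup>2 * 2 ^ (Suc t * Suc t)"
    by (simp add: graph_order_def power_mult add.commute del: power_Suc mult_Suc mult_Suc_right)
  also have "log 2 \<dots> = 2 * log 2 (real t + 1) + real (Suc t * Suc t)"
    by (simp add: log_mult log_nat_power del: power_Suc mult_Suc mult_Suc_right)
  finally show ?thesis by (simp add: power2_eq_square algebra_simps)
qed

lemma graph_order_tendsto_infinity: "filterlim graph_order at_top sequentially"
proof (rule filterlim_at_top_mono[OF filterlim_ident])
  have "t \<le> graph_order t" for t
  proof -
    have "t * 1 \<le> (Suc t)\<^sup>2 * (2 ^ Suc t) ^ Suc t"
      by (intro mult_mono) (auto simp: power2_eq_square)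
    then show ?thesis by (simp add: graph_order_def)
  qed
  then show "\<forall>\<^sub>F t in sequentially. t \<le> graph_order t" by simp
qed

lemma cis_nondet_cc_ge_log:
  assumes "0 < n" "n \<le> cis_cover_number V E"
  shows "log 2 (real n) \<le> cis_nondet_cc V E"
  using assms by (simp add: cis_nondet_cc_def)

lemma graph_with_nondet_cc_ge:
  "\<exists>E. fin_sgraph {..<graph_order t} E \<and>
    (2 * real t + 1) * (real t + 1) \<le> cis_nondet_cc {..<graph_order t} E"
proof -
  obtain E where graph: "fin_sgraph {..<graph_order t} E"
    and large: "(2 ^ Suc t) ^ (2 * t + 1) \<le> cis_cover_number {..<graph_order t} E"
    using graph_with_cover_number_ge_power[of "2 ^ Suc t" t] by (auto simp: graph_order_def)
  have "(2 * real t + 1) * (real t + 1) = log 2 (real ((2 ^ Suc t) ^ (2 * t + 1)))"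
    by (simp add: log_nat_power algebra_simps del: power_Suc)
  also have "\<dots> \<le> cis_nondet_cc {..<graph_order t} E"
    by (rule cis_nondet_cc_ge_log[OF _ large]) simp
  finally show ?thesis using graph by blast
qed

theorem theorem3:
  shows "\<exists>(V :: nat \<Rightarrow> nat set) (E :: nat \<Rightarrow> nat set set) (\<epsilon> :: nat \<Rightarrow> real).
    (\<forall>t. fin_sgraph (V t) (E t)) \<and>
    filterlim (\<lambda>t. card (V t)) at_top sequentially \<and>
    \<epsilon> \<longlonglongrightarrow> 0 \<and>
    (\<forall>t. cis_nondet_cc (V t) (E t) \<ge> (2 - \<epsilon> t) * log 2 (real (card (V t))))"
proof -
  obtain E where graph: "\<And>t. fin_sgraph {..<graph_order t} (E t)"
    and nondet_cc_ge: "\<And>t. (2 * real t + 1) * (real t + 1) \<le> cis_nondet_cc {..<graph_order t} (E t)"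
    using graph_with_nondet_cc_ge by metis
  define \<epsilon> where "\<epsilon> t = 2 - (2 * real t + 1) * (real t + 1) / log 2 (graph_order t)" for t
  have "\<epsilon> \<longlonglongrightarrow> 0"
    unfolding \<epsilon>_def log_graph_order by real_asymp
  moreover have "(2 - \<epsilon> t) * log 2 (graph_order t) \<le> cis_nondet_cc {..<graph_order t} (E t)" for t
  proof -
    have "log 2 (graph_order t) > 0"
      unfolding log_graph_order by (intro add_nonneg_pos) auto
    then show ?thesis using nondet_cc_ge[of t] by (simp add: \<epsilon>_def)
  qed
  ultimately show ?thesis
    using graph graph_order_tendsto_infinity
    by (intro exI[of _ "\<lambda>t. {..<graph_order t}"] exI[of _ E] exI[of _ \<epsilon>]) simp
qed

end
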